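(* Let $A=(f_1,\dots,f_k)$ be a system of tropical polynomials in $n$ variables with finite coefficients, and let $V\subset\mathbb{R}^n$ be the tropical prevariety given by $A$. Then every connected component of $V$ contains at least one generalized vertex of $A$.
   Context: A tropical polynomial $f$ in $n$ variables is given by a nonempty finite set of tropical monomials $Q_j(x)=a_j+i_{j1}x_1+\cdots+i_{jn}x_n$ with $a_j\in\mathbb{R}$ and pairwise distinct exponent vectors $(i_{j1},\dots,i_{jn})\in\mathbb{Z}_{\ge 0}^n$; $f(x)=\min_j Q_j(x)$. The tropical degree of $Q_j$ is $i_{j1}+\cdots+i_{jn}$, and the tropical degree of $f$ is the maximum of the degrees of its monomials. A tropical polynomial of tropical degree $e$ has finite coefficients if every monomial of tropical degree at most $e$ occurs in it. A point $x\in\mathbb{R}^n$ is a tropical zero of $f$ if $\min_j Q_j(x)$ is attained for at least two different $j$. The tropical prevariety given by $A$ is the set of all $x\in\mathbb{R}^n$ that are tropical zeros of every $f_i$. Star table: for $x\in\mathbb{R}^n$, $A^{*x}$ is the table whose rows correspond to the polynomials of $A$ and whose columns correspond to the monomials (exponent vectors) in $n$ variables; the entry $(i,m)$ carries a star if and only if the monomial with exponent vector $m$ occurs in $f_i$ and attains at $x$ the minimal value among all monomials of $f_i$. Star tables are ordered by inclusion of their sets of starred entries. A point $x$ is a generalized vertex of $A$ if for every point $y\ne x$ of $\mathbb{R}^n$ the table $A^{*y}$ does not contain $A^{*x}$. *)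

theory Defs
  imports "HOL-Analysis.Analysis"
begin

text \<open>
  A tropical polynomial in the variables indexed by \<open>'n\<close> is a partial map with finite nonempty
  domain: it sends the exponent vector of each occurring monomial to the coefficient of that
  monomial. A monomial outside the domain does not occur (its coefficient is infinite).
\<close>

type_synonym 'n trop_poly = "(nat, 'n) vec \<Rightarrow> real option"

definition is_trop_poly :: "'n::finite trop_poly \<Rightarrow> bool" where
  "is_trop_poly f \<longleftrightarrow> finite (dom f) \<and> dom f \<noteq> {}"

definition monom_degree :: "nat ^ 'n \<Rightarrow> nat" where
  "monom_degree m = (\<Sum>v\<in>UNIV. m $ v)"

definition trop_degree :: "'n::finite trop_poly \<Rightarrow> nat" where
  "trop_degree f = Max (monom_degree ` dom f)"

definition finite_coefficients :: "'n::finite trop_poly \<Rightarrow> bool" where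
  "finite_coefficients f \<longleftrightarrow> (\<forall>m. monom_degree m \<le> trop_degree f \<longrightarrow> m \<in> dom f)"

text \<open>Only meaningful for \<open>m \<in> dom f\<close>; all uses below are guarded accordingly.\<close>

definition monom_value :: "'n::finite trop_poly \<Rightarrow> nat ^ 'n \<Rightarrow> real ^ 'n \<Rightarrow> real" where
  "monom_value f m x = the (f m) + (\<Sum>v\<in>UNIV. real (m $ v) * x $ v)"

definition trop_eval :: "'n::finite trop_poly \<Rightarrow> real ^ 'n \<Rightarrow> real" where
  "trop_eval f x = Min ((\<lambda>m. monom_value f m x) ` dom f)"

definition attains_min :: "'n::finite trop_poly \<Rightarrow> nat ^ 'n \<Rightarrow> real ^ 'n \<Rightarrow> bool" where
  "attains_min f m x \<longleftrightarrow> m \<in> dom f \<and> monom_value f m x = trop_eval f x"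

definition trop_zero :: "'n::finite trop_poly \<Rightarrow> real ^ 'n \<Rightarrow> bool" where
  "trop_zero f x \<longleftrightarrow> (\<exists>m m'. m \<noteq> m' \<and> attains_min f m x \<and> attains_min f m' x)"

definition prevariety :: "'n::finite trop_poly list \<Rightarrow> (real ^ 'n) set" where
  "prevariety A = {x. \<forall>f\<in>set A. trop_zero f x}"

text \<open>A star table is represented by the set of its starred entries (row, column).\<close>

definition star_table :: "'n::finite trop_poly list \<Rightarrow> real ^ 'n \<Rightarrow> (nat \<times> (nat ^ 'n)) set" where
  "star_table A x = {(i, m). i < length A \<and> attains_min (A ! i) m x}"

definition generalized_vertex :: "'n::finite trop_poly list \<Rightarrow> real ^ 'n \<Rightarrow> bool" where
  "generalized_vertex A x \<longleftrightarrow> (\<forall>y. y \<noteq> x \<longrightarrow> \<not> star_table A x \<subseteq> star_table A y)"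

end

theory Submission
  imports Defs
begin

text \<open>
  For a set \<open>T\<close> of stars the points whose star table contains \<open>T\<close> form a cell: a finite
  intersection of half-spaces, hence a closed convex set. When \<open>T\<close> is the star table of a point
  of the prevariety, the cell stays inside the prevariety, because every row keeps its two stars,
  and so, being connected, inside one component.

  Only finitely many star tables exist, so every component \<open>C\<close> contains a point \<open>x\<close> whose star
  table \<open>T\<close> is maximal among the points of \<open>C\<close>. Then every point of the cell of \<open>T\<close> has star table
  exactly \<open>T\<close>. Consider a line through two points of the cell. Monomials that tie at both points tie
  on the whole line, so a star of \<open>T\<close> can be lost along the line only where some row gains a star
  outside \<open>T\<close>, and missing stars do not appear under a small perturbation. So the cell is not only
  closed but open along the line, and therefore contains it. Along a
  full line the minimal monomials of a polynomial can stay minimal only if all its monomials have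
  the same slope. Finite coefficients exclude this: the constant monomial and all the variables
  occur, so the common slope is zero in every coordinate. Hence the cell is the single point \<open>x\<close>,
  which says that \<open>x\<close> is a generalized vertex.
\<close>

section \<open>Monomials as affine functions\<close>

definition real_exponent :: "nat ^ 'n \<Rightarrow> real ^ 'n" where
  "real_exponent m = (\<chi> v. real (m $ v))"

lemma monom_value_eq_inner:
  "monom_value f m x = the (f m) + real_exponent m \<bullet> x"
  by (simp add: monom_value_def real_exponent_def inner_vec_def)

lemma attains_min_iff:
  assumes "is_trop_poly f"
  shows "attains_min f m x \<longleftrightarrow>
    m \<in> dom f \<and> (\<forall>m'\<in>dom f. monom_value f m x \<le> monom_value f m' x)"
proof (cases "m \<in> dom f")
  case True
  have fin: "finite ((\<lambda>m. monom_value f m x) ` dom f)"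
    using assms by (simp add: is_trop_poly_def)
  have "monom_value f m x = trop_eval f x \<longleftrightarrow>
      (\<forall>a\<in>(\<lambda>m. monom_value f m x) ` dom f. monom_value f m x \<le> a)"
    unfolding trop_eval_def using True
    by (metis (no_types, lifting) Min_eqI Min_le fin imageI)
  with True show ?thesis
    by (simp add: attains_min_def)
qed (simp add: attains_min_def)

lemma attains_min_exists:
  assumes "is_trop_poly f"
  shows "\<exists>m. attains_min f m x"
proof -
  have "Min ((\<lambda>m. monom_value f m x) ` dom f) \<in> (\<lambda>m. monom_value f m x) ` dom f"
    using assms by (intro Min_in) (simp_all add: is_trop_poly_def)
  then show ?thesis
    by (auto simp: attains_min_def trop_eval_def)
qed

lemma attains_min_set_eq_halfspaces:
  assumes "is_trop_poly f" "m \<in> dom f"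
  shows "{x. attains_min f m x} =
    (\<Inter>m'\<in>dom f. {x. (real_exponent m - real_exponent m') \<bullet> x \<le> the (f m') - the (f m)})"
  using assms by (auto simp: attains_min_iff monom_value_eq_inner inner_diff_left algebra_simps)

lemma closed_attains_min:
  assumes "is_trop_poly f"
  shows "closed {x. attains_min f m x}"
proof (cases "m \<in> dom f")
  case True
  then show ?thesis
    by (simp add: attains_min_set_eq_halfspaces assms closed_INT closed_halfspace_le)
qed (simp add: attains_min_def)

lemma convex_attains_min:
  assumes "is_trop_poly f"
  shows "convex {x. attains_min f m x}"
proof (cases "m \<in> dom f")
  case True
  then show ?thesis
    by (simp add: attains_min_set_eq_halfspaces assms convex_INT convex_halfspace_le)
qed (simp add: attains_min_def)

text \<open>
  Going to infinity in both directions of the line, a monomial of different slope would drop below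
  \<open>m\<close> on one of the two sides.
\<close>

lemma slopes_equal_if_minimal_on_line:
  assumes "is_trop_poly f"
    and line: "\<And>t. attains_min f m (x + t *\<^sub>R d)"
    and "m' \<in> dom f"
  shows "real_exponent m \<bullet> d = real_exponent m' \<bullet> d"
proof (rule ccontr)
  define s where "s = real_exponent m \<bullet> d - real_exponent m' \<bullet> d"
  define b where "b = monom_value f m' x - monom_value f m x"
  assume "real_exponent m \<bullet> d \<noteq> real_exponent m' \<bullet> d"
  then have "s \<noteq> 0" by (simp add: s_def)
  have le: "t * s \<le> b" for t
    using line[of t] assms(1,3)
    by (auto simp: attains_min_iff monom_value_eq_inner s_def b_def inner_add_right algebra_simps)
  have "b + 1 \<le> b"
    using le[of "(b + 1) / s"] \<open>s \<noteq> 0\<close> by simp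
  then show False by simp
qed

text \<open>
  A zero needs two monomials, so the degree is at least one; the constant monomial and every
  variable then occur, and comparing their slopes isolates each coordinate of \<open>d\<close>.
\<close>

lemma direction_zero_if_slopes_equal:
  fixes f :: "'n::finite trop_poly"
  assumes "is_trop_poly f" "finite_coefficients f" "trop_zero f x"
    and slopes: "\<And>m m'. m \<in> dom f \<Longrightarrow> m' \<in> dom f \<Longrightarrow>
      real_exponent m \<bullet> d = real_exponent m' \<bullet> d"
  shows "d = 0"
proof -
  obtain m m' where m: "m \<noteq> m'" "m \<in> dom f" "m' \<in> dom f"
    using assms(3) by (auto simp: trop_zero_def attains_min_def)
  have degree: "monom_degree k \<le> trop_degree f" if "k \<in> dom f" for k
    using that assms(1) by (simp add: trop_degree_def is_trop_poly_def)
  have zero: "k = 0" if "monom_degree k = 0" for k :: "nat ^ 'n"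
    using that by (simp add: monom_degree_def vec_eq_iff)
  have "trop_degree f \<noteq> 0"
  proof
    assume "trop_degree f = 0"
    then have "m = 0" "m' = 0"
      using degree[OF m(2)] degree[OF m(3)] by (simp_all add: zero)
    with m(1) show False by simp
  qed
  have "d $ i = 0" for i
  proof -
    have "monom_degree (axis i 1) = 1"
      by (simp add: monom_degree_def axis_def)
    moreover have "monom_degree (0 :: nat ^ 'n) = 0"
      by (simp add: monom_degree_def)
    ultimately have "axis i 1 \<in> dom f" "0 \<in> dom f"
      using assms(2) \<open>trop_degree f \<noteq> 0\<close> unfolding finite_coefficients_def
      by (metis One_nat_def Suc_leI neq0_conv, metis le0)
    then have "real_exponent (axis i 1) \<bullet> d = real_exponent 0 \<bullet> d"
      by (rule slopes)
    moreover have "real_exponent (axis i 1) = axis i 1"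
      by (simp add: real_exponent_def axis_def vec_eq_iff)
    moreover have "real_exponent (0 :: nat ^ 'n) = 0"
      by (simp add: real_exponent_def vec_eq_iff)
    ultimately show ?thesis
      by (simp add: inner_axis')
  qed
  then show ?thesis
    by (simp add: vec_eq_iff)
qed

section \<open>Cells of star tables\<close>

lemma finite_star_entries:
  assumes "\<And>f. f \<in> set A \<Longrightarrow> is_trop_poly f"
  shows "finite (SIGMA i:{..<length A}. dom (A ! i))"
  using assms by (auto simp: is_trop_poly_def)

lemma star_table_subset_entries:
  "star_table A x \<subseteq> (SIGMA i:{..<length A}. dom (A ! i))"
  by (auto simp: star_table_def attains_min_def)

lemma
  assumes "\<And>f. f \<in> set A \<Longrightarrow> is_trop_poly f"
  shows closed_star_cell: "closed {y. T \<subseteq> star_table A y}"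
    and convex_star_cell: "convex {y. T \<subseteq> star_table A y}"
proof -
  have eq: "{y. T \<subseteq> star_table A y} =
      (\<Inter>(i, m)\<in>T. if i < length A then {y. attains_min (A ! i) m y} else {})"
    by (auto simp: star_table_def split: if_splits)
  show "closed {y. T \<subseteq> star_table A y}"
    unfolding eq by (intro closed_INT ballI) (auto simp: closed_attains_min assms)
  show "convex {y. T \<subseteq> star_table A y}"
    unfolding eq by (intro convex_INT) (auto simp: convex_attains_min assms)
qed

text \<open>
  Semicontinuity of star tables: a missing star stays missing nearby. The set is the complement of
  the finitely many closed sets on which some entry outside \<open>T\<close> is starred.
\<close>

lemma open_star_table_subset:
  assumes "\<And>f. f \<in> set A \<Longrightarrow> is_trop_poly f"
  shows "open {y. star_table A y \<subseteq> T}"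
proof -
  define E where "E = (SIGMA i:{..<length A}. dom (A ! i))"
  have "{y. star_table A y \<subseteq> T} = - (\<Union>(i, m)\<in>E - T. {y. attains_min (A ! i) m y})"
    by (auto simp: star_table_def E_def attains_min_def)
  moreover have "closed (\<Union>(i, m)\<in>E - T. {y. attains_min (A ! i) m y})"
    using finite_star_entries[OF assms]
    by (intro closed_UN) (auto simp: E_def closed_attains_min assms)
  ultimately show ?thesis
    by (metis open_Compl)
qed

lemma prevariety_star_table_mono:
  assumes "x \<in> prevariety A" "star_table A x \<subseteq> star_table A y"
  shows "y \<in> prevariety A"
  unfolding prevariety_def
proof (intro CollectI ballI)
  fix f assume "f \<in> set A"
  then obtain i where i: "i < length A" "f = A ! i"
    by (metis in_set_conv_nth)
  have "attains_min f m y" if "attains_min f m x" for m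
    using assms(2) that i by (auto simp: star_table_def)
  then show "trop_zero f y"
    using assms(1) \<open>f \<in> set A\<close> unfolding prevariety_def trop_zero_def by blast
qed

lemma star_cell_subset_component:
  assumes "\<And>f. f \<in> set A \<Longrightarrow> is_trop_poly f"
    and "C \<in> components (prevariety A)" "x \<in> C"
  shows "{y. star_table A x \<subseteq> star_table A y} \<subseteq> C"
proof (rule components_maximal[OF assms(2)])
  show "connected {y. star_table A x \<subseteq> star_table A y}"
    by (intro convex_connected convex_star_cell assms(1))
  have "x \<in> prevariety A"
    using assms(2,3) in_components_subset by blast
  then show "{y. star_table A x \<subseteq> star_table A y} \<subseteq> prevariety A"
    using prevariety_star_table_mono by blast
  show "C \<inter> {y. star_table A x \<subseteq> star_table A y} \<noteq> {}"
    using assms(3) by auto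
qed

section \<open>Maximal star tables\<close>

text \<open>
  On the line through two points of the cell, the monomials starred in one row of the table tie at
  both points, hence everywhere on the line. So if the minimum of that row is attained by one of
  them, it is attained by all of them: no star can be lost as long as none is gained.
\<close>

lemma star_table_subset_on_cell_line:
  assumes poly: "\<And>f. f \<in> set A \<Longrightarrow> is_trop_poly f"
    and cell: "star_table A x \<subseteq> star_table A (x + d)"
    and sub: "star_table A (x + t *\<^sub>R d) \<subseteq> star_table A x"
  shows "star_table A x \<subseteq> star_table A (x + t *\<^sub>R d)"
proof clarify
  fix i m assume im: "(i, m) \<in> star_table A x"
  define f where "f = A ! i"
  have i: "i < length A" and m0: "attains_min f m x"
    using im by (auto simp: star_table_def f_def)
  have m1: "attains_min f m (x + d)"
    using im cell by (auto simp: star_table_def f_def)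
  have "is_trop_poly f"
    using i by (simp add: f_def poly)
  then obtain k where k: "attains_min f k (x + t *\<^sub>R d)"
    using attains_min_exists by blast
  then have k': "(i, k) \<in> star_table A x"
    using i sub by (auto simp: star_table_def f_def)
  then have k0: "attains_min f k x" and k1: "attains_min f k (x + d)"
    using cell by (auto simp: star_table_def f_def)
  have e0: "monom_value f m x = monom_value f k x"
    using m0 k0 by (simp add: attains_min_def)
  have "monom_value f m (x + d) = monom_value f k (x + d)"
    using m1 k1 by (simp add: attains_min_def)
  with e0 have "real_exponent m \<bullet> d = real_exponent k \<bullet> d"
    by (simp add: monom_value_eq_inner inner_add_right)
  with e0 have "monom_value f m (x + t *\<^sub>R d) = monom_value f k (x + t *\<^sub>R d)"
    by (simp add: monom_value_eq_inner inner_add_right)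
  then have "attains_min f m (x + t *\<^sub>R d)"
    using k m0 by (simp add: attains_min_def)
  then show "(i, m) \<in> star_table A (x + t *\<^sub>R d)"
    using i by (simp add: star_table_def f_def)
qed

text \<open>
  If no point of the cell has a star outside the table of \<open>x\<close>, the parameters of the line that lie
  in the cell form a set that is both closed and open, so the line never leaves the cell.
\<close>

lemma maximal_star_cell_contains_line:
  assumes poly: "\<And>f. f \<in> set A \<Longrightarrow> is_trop_poly f"
    and max: "\<And>y. star_table A x \<subseteq> star_table A y \<Longrightarrow> star_table A y = star_table A x"
    and cell: "star_table A x \<subseteq> star_table A (x + d)"
  shows "star_table A x \<subseteq> star_table A (x + t *\<^sub>R d)"
proof -
  define g where "g = (\<lambda>t. x + t *\<^sub>R d)"
  define S where "S = g -` {y. star_table A x \<subseteq> star_table A y}"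
  have cont: "continuous_on UNIV g"
    unfolding g_def by (intro continuous_intros)
  have "S = g -` {y. star_table A y \<subseteq> star_table A x}"
    using star_table_subset_on_cell_line[OF poly cell] max by (auto simp: S_def g_def)
  then have "open S"
    using open_vimage[OF open_star_table_subset[OF poly] cont] by simp
  moreover have "closed S"
    unfolding S_def by (intro closed_vimage closed_star_cell poly cont)
  moreover have "0 \<in> S"
    by (simp add: S_def g_def)
  ultimately have "S = UNIV"
    using clopen[of S] by blast
  then show ?thesis
    by (auto simp: S_def g_def)
qed

theorem theorem6p1:
  fixes A :: "'n::finite trop_poly list" and C :: "(real ^ 'n) set"
  assumes "A \<noteq> []"
    and "\<And>f. f \<in> set A \<Longrightarrow> is_trop_poly f"
    and "\<And>f. f \<in> set A \<Longrightarrow> finite_coefficients f"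
    and "C \<in> components (prevariety A)"
  shows "\<exists>x\<in>C. generalized_vertex A x"
proof -
  have "finite (star_table A ` C)"
  proof (rule finite_subset)
    show "star_table A ` C \<subseteq> Pow (SIGMA i:{..<length A}. dom (A ! i))"
      using star_table_subset_entries by auto
    show "finite (Pow (SIGMA i:{..<length A}. dom (A ! i)))"
      using finite_star_entries[of A] assms(2) unfolding finite_Pow_iff by blast
  qed
  moreover have "star_table A ` C \<noteq> {}"
    using in_components_nonempty[OF assms(4)] by simp
  ultimately obtain x where "x \<in> C"
    and max_C: "\<And>y. y \<in> C \<Longrightarrow> star_table A x \<subseteq> star_table A y \<Longrightarrow> star_table A x = star_table A y"
    using finite_has_maximal[of "star_table A ` C"] by (auto simp: image_iff)
  have max: "star_table A y = star_table A x" if "star_table A x \<subseteq> star_table A y" for y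
    using star_cell_subset_component[OF assms(2,4) \<open>x \<in> C\<close>] max_C that by blast
  have "y = x" if y: "star_table A x \<subseteq> star_table A y" for y
  proof -
    define f where "f = A ! 0"
    define d where "d = y - x"
    have f: "f \<in> set A"
      using assms(1) by (simp add: f_def)
    have "x \<in> prevariety A"
      using in_components_subset[OF assms(4)] \<open>x \<in> C\<close> by blast
    then have zero: "trop_zero f x"
      using f by (simp add: prevariety_def)
    then obtain m where "attains_min f m x"
      by (auto simp: trop_zero_def)
    then have "(0, m) \<in> star_table A x"
      using assms(1) by (simp add: star_table_def f_def)
    moreover have "star_table A x \<subseteq> star_table A (x + t *\<^sub>R d)" for t
      using maximal_star_cell_contains_line[OF assms(2) max] y by (simp add: d_def)
    ultimately have "(0, m) \<in> star_table A (x + t *\<^sub>R d)" for t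
      by blast
    then have "attains_min f m (x + t *\<^sub>R d)" for t
      by (simp add: star_table_def f_def)
    then have "real_exponent m \<bullet> d = real_exponent m' \<bullet> d" if "m' \<in> dom f" for m'
      using slopes_equal_if_minimal_on_line assms(2)[OF f] that by blast
    then have "d = 0"
      by (intro direction_zero_if_slopes_equal[OF assms(2)[OF f] assms(3)[OF f] zero]) metis
    then show "y = x"
      by (simp add: d_def)
  qed
  with \<open>x \<in> C\<close> show ?thesis
    unfolding generalized_vertex_def by blast
qed

end
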